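(* Let $S\subset\mathbb{R}^n$ be a simplex with vertices $v_0,\dots,v_n$ and barycenter $\mathbf{b}$, and let $c>0$. If $f: S \to \mathbb{R}$ is strongly convex with modulus $c$, then \[ f(\mathbf{b})+c\biggl(\frac{1}{|S|}\int_S\|x\|^2\,\mathrm{d}x-\|\mathbf{b}\|^2\biggr) \leq\frac{1}{|S|}\int_Sf(x)\,\mathrm{d}x \leq\frac{1}{n+1}\sum_{i=0}^nf(v_i) +c\biggl(\frac{1}{|S|}\int_S\|x\|^2\,\mathrm{d}x-\frac{1}{n+1}\sum_{i=0}^n\|v_i\|^2\biggr). \]
   Context: A simplex with vertices $v_0,\dots,v_n\in\mathbb{R}^n$ is $S=\mathrm{conv}\{v_0,\dots,v_n\}$ where $v_0,\dots,v_n$ are affinely independent; $|S|$ denotes its volume and $\mathbf{b}=\frac{1}{n+1}\sum_{i=0}^n v_i$ its barycenter. $\|\cdot\|$ is the Euclidean norm. For a convex set $D\subset\mathbb{R}^n$ and $c>0$, a function $f:D\to\mathbb{R}$ is strongly convex with modulus $c$ if $f(tx+(1-t)y)\le tf(x)+(1-t)f(y)-ct(1-t)\|x-y\|^2$ for all $x,y\in D$ and $t\in[0,1]$. *)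

theory Defs
  imports "HOL-Analysis.Analysis"
begin

definition strongly_convex_on :: "real \<Rightarrow> 'a::real_normed_vector set \<Rightarrow> ('a \<Rightarrow> real) \<Rightarrow> bool"
  where "strongly_convex_on c D f \<longleftrightarrow> convex D \<and>
    (\<forall>x\<in>D. \<forall>y\<in>D. \<forall>t\<in>{0..1}.
      f (t *\<^sub>R x + (1 - t) *\<^sub>R y)
        \<le> t * f x + (1 - t) * f y - c * t * (1 - t) * (norm (x - y))\<^sup>2)"

text \<open>
  The library's \<^const>\<open>affine_dependent\<close> is a property of sets, so affine independence of an
  indexed family additionally requires that no point is repeated.
\<close>

definition affinely_independent_family :: "('i \<Rightarrow> 'a::real_vector) \<Rightarrow> 'i set \<Rightarrow> bool"
  where "affinely_independent_family v I \<longleftrightarrow> inj_on v I \<and> \<not> affine_dependent (v ` I)"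

definition barycenter :: "nat \<Rightarrow> (nat \<Rightarrow> 'a::real_vector) \<Rightarrow> 'a"
  where "barycenter n v = (1 / real (n + 1)) *\<^sub>R (\<Sum>i=0..n. v i)"

text \<open>
  Average over \<open>S\<close> with respect to Lebesgue measure. The completed measure is used because
  convex functions on a closed simplex need not be Borel measurable on its boundary.
\<close>

definition average :: "'a::euclidean_space set \<Rightarrow> ('a \<Rightarrow> real) \<Rightarrow> real"
  where "average S f = 1 / measure lebesgue S * (LINT x:S|lebesgue. f x)"

end

theory Submission
  imports Defs
begin

text \<open>
  Strong convexity of \<open>f\<close> with modulus \<open>c\<close> means that \<open>g x = f x - c * (norm x)\<^sup>2\<close> is convex.
  Averages are linear, so both inequalities are the Hermite--Hadamard inequalities
  \<open>g b \<le> average S g \<le> (\<Sum>i=0..n. g (v i)) / (n + 1)\<close> for the convex function \<open>g\<close>,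
  with the terms in \<open>(norm x)\<^sup>2\<close> moved back to the outer sides.

  These are obtained from the symmetry of the simplex. Let \<open>T\<close> be the affine map that permutes the
  vertices cyclically, \<open>v 0 \<mapsto> v 1 \<mapsto> \<dots> \<mapsto> v n \<mapsto> v 0\<close>. In barycentric coordinates \<open>T\<close> rotates the
  coordinates, so the points \<open>x, T x, \<dots>, T\<^sup>n x\<close> of an orbit have centroid \<open>b\<close>, and each vertex
  receives total weight \<open>1\<close> along the orbit. Jensen's inequality, used once for the centroid and once for
  each point of the orbit, gives for all \<open>x \<in> S\<close>
  \<open>(n + 1) * g b \<le> (\<Sum>k=0..n. g (T\<^sup>k x)) \<le> (\<Sum>i=0..n. g (v i))\<close>
  (lemma \<open>convex_orbit_bounds\<close>). Since \<open>T\<close> preserves Lebesgue measure, each of the \<open>n + 1\<close> summands in the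
  middle has the same integral as \<open>g\<close>, and integration over \<open>S\<close> finishes the proof.

  \<open>T\<close> preserves Lebesgue measure because it maps the interior of \<open>S\<close>, a set of positive finite measure, onto itself:
  the image of Lebesgue measure under an affine bijection is translation invariant, hence a multiple of
  Lebesgue measure, and the measure of this set fixes the factor to be \<open>1\<close>
  (lemma \<open>affine_image_eq_imp_distr_lborel\<close>). No determinant has to be computed.

  Integrability of \<open>g\<close> holds because \<open>g\<close> is continuous on the interior of \<open>S\<close> and bounded on \<open>S\<close>, and
  because the frontier of a convex set is negligible. The integrals are therefore evaluated over the
  interior, where \<open>g\<close> is Borel measurable; on the frontier it need not be.
\<close>

section \<open>Affine symmetries preserve Lebesgue measure\<close>

text \<open>
  The measure-theoretic core of the uniqueness of Haar measure: both sides are the double integral of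
  \<open>indicator A x * indicator B (x + y)\<close>, evaluated once by shifting \<open>y\<close> by \<open>x\<close>, and once by
  exchanging the integrals, shifting \<open>x\<close> by \<open>- y\<close> and then \<open>y\<close> by \<open>x\<close>.
\<close>

lemma translation_invariant_emeasure_swap:
  fixes \<nu> :: "'a::euclidean_space measure"
  assumes [measurable_cong]: "sets \<nu> = sets borel" and "sigma_finite_measure \<nu>"
    and inv: "\<And>a. distr \<nu> borel ((+) a) = \<nu>"
    and [measurable]: "A \<in> sets borel" "B \<in> sets borel"
  shows "emeasure lborel A * emeasure \<nu> B = emeasure lborel B * emeasure \<nu> (uminus -` A)"
proof -
  interpret \<nu>: sigma_finite_measure \<nu> by fact
  interpret pair_sigma_finite lborel \<nu> ..
  have shift_\<nu>: "(\<integral>\<^sup>+y. h (x + y) \<partial>\<nu>) = (\<integral>\<^sup>+y. h y \<partial>\<nu>)"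
    if [measurable]: "h \<in> borel_measurable borel" for h :: "'a \<Rightarrow> ennreal" and x
    by (subst (2) inv[of x, symmetric], subst nn_integral_distr) auto
  have shift: "(\<integral>\<^sup>+x. h (x + y) \<partial>lborel) = (\<integral>\<^sup>+x. h x \<partial>lborel)"
    if [measurable]: "h \<in> borel_measurable borel" for h :: "'a \<Rightarrow> ennreal" and y
    by (subst (2) lborel_distr_plus[of y, symmetric], subst nn_integral_distr) (auto simp: add.commute)
  have "emeasure lborel A * emeasure \<nu> B
      = (\<integral>\<^sup>+x. indicator A x * (\<integral>\<^sup>+y. indicator B (x + y) \<partial>\<nu>) \<partial>lborel)"
    by (simp add: shift_\<nu> nn_integral_multc)
  also have "\<dots> = (\<integral>\<^sup>+x. (\<integral>\<^sup>+y. indicator A x * indicator B (x + y) \<partial>\<nu>) \<partial>lborel)"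
    by (simp add: nn_integral_cmult)
  also have "\<dots> = (\<integral>\<^sup>+y. (\<integral>\<^sup>+x. indicator A x * indicator B (x + y) \<partial>lborel) \<partial>\<nu>)"
    by (subst Fubini') auto
  also have "\<dots> = (\<integral>\<^sup>+y. (\<integral>\<^sup>+x. indicator A (x - y) * indicator B x \<partial>lborel) \<partial>\<nu>)"
  proof -
    have "(\<integral>\<^sup>+x. indicator A x * indicator B (x + y) \<partial>lborel)
        = (\<integral>\<^sup>+x. indicator A (x - y) * indicator B x \<partial>lborel)" for y
      using shift[of "\<lambda>x. indicator A (x - y) * indicator B x" y] by simp
    then show ?thesis by simp
  qed
  also have "\<dots> = (\<integral>\<^sup>+x. (\<integral>\<^sup>+y. indicator A (x - y) * indicator B x \<partial>\<nu>) \<partial>lborel)"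
    by (subst Fubini') auto
  also have "\<dots> = (\<integral>\<^sup>+x. (\<integral>\<^sup>+y. indicator A (x - y) \<partial>\<nu>) * indicator B x \<partial>lborel)"
    by (simp add: nn_integral_multc)
  also have "\<dots> = (\<integral>\<^sup>+x. (\<integral>\<^sup>+y. indicator A (- y) \<partial>\<nu>) * indicator B x \<partial>lborel)"
  proof -
    have "(\<integral>\<^sup>+y. indicator A (x - y) \<partial>\<nu>) = (\<integral>\<^sup>+y. indicator A (- y) \<partial>\<nu>)" for x
      using shift_\<nu>[of "\<lambda>y. indicator A (x - y)" x] by simp
    then show ?thesis by simp
  qed
  also have "\<dots> = (\<integral>\<^sup>+x. emeasure \<nu> (uminus -` A) * indicator B x \<partial>lborel)"
  proof -
    have "(\<integral>\<^sup>+y. indicator A (- y) \<partial>\<nu>) = emeasure \<nu> (uminus -` A)"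
    proof -
      have "uminus -` A \<in> sets \<nu>"
        using measurable_sets[of uminus borel borel A] assms(1) by simp
      moreover have "(\<lambda>y. indicator A (- y)) = (indicator (uminus -` A) :: 'a \<Rightarrow> ennreal)"
        by (auto simp: indicator_def)
      ultimately show ?thesis by simp
    qed
    then show ?thesis by (simp add: mult.commute)
  qed
  also have "(\<integral>\<^sup>+x. emeasure \<nu> (uminus -` A) * indicator B x \<partial>lborel)
      = emeasure lborel B * emeasure \<nu> (uminus -` A)"
    by (subst nn_integral_cmult_indicator) (simp_all add: mult.commute)
  finally show ?thesis .
qed

text \<open>
  With \<open>S\<close> in the role of \<open>B\<close>, the exchange identity says that \<open>\<nu>\<close> is the reflection of Lebesgue measure,
  which is Lebesgue measure itself. The common finite nonzero value on \<open>S\<close> is what allows cancellation.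
\<close>

lemma translation_invariant_eq_lborel:
  fixes \<nu> :: "'a::euclidean_space measure"
  assumes sets: "sets \<nu> = sets borel" and sf: "sigma_finite_measure \<nu>"
    and inv: "\<And>a. distr \<nu> borel ((+) a) = \<nu>"
    and S: "S \<in> sets borel" "emeasure \<nu> S = emeasure lborel S"
      "emeasure lborel S \<noteq> 0" "emeasure lborel S \<noteq> \<infinity>"
  shows "\<nu> = lborel"
proof (rule measure_eqI)
  fix A assume "A \<in> sets \<nu>"
  then have A: "A \<in> sets borel" by (simp add: sets)
  have "emeasure lborel S * emeasure lborel B = emeasure lborel S * emeasure \<nu> (uminus -` B)"
    if "B \<in> sets borel" for B
    using translation_invariant_emeasure_swap[OF sets sf inv that S(1)] S(2) by (simp add: mult.commute)
  then have *: "emeasure lborel B = emeasure \<nu> (uminus -` B)" if "B \<in> sets borel" for B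
    using that S(3,4) by (simp add: ennreal_mult_cancel_left)
  have "emeasure \<nu> A = emeasure \<nu> (uminus -` uminus -` A)"
    by (simp add: vimage_def)
  also have "\<dots> = emeasure lborel (uminus -` A)"
    using measurable_sets[of uminus borel borel A] A by (subst *) auto
  also have "\<dots> = emeasure (distr lborel borel uminus) A"
    using A by (simp add: emeasure_distr)
  also have "\<dots> = emeasure lborel A"
    using lborel_affine[of "-1::real" "0::'a"] by (simp add: density_1)
  finally show "emeasure \<nu> A = emeasure lborel A" .
qed (simp add: sets)

text \<open>
  Translating the image by \<open>b\<close> amounts to translating the argument of \<open>T\<close> by the \<open>d\<close> with \<open>L d = b\<close>,
  so the image measure inherits translation invariance from Lebesgue measure.
\<close>

lemma affine_image_eq_imp_distr_lborel:
  fixes L :: "'a::euclidean_space \<Rightarrow> 'a" and a :: 'a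
  defines "T \<equiv> (\<lambda>x. L x + a)"
  assumes L: "linear L" "inj L" and S: "S \<in> sets borel" "T ` S = S"
      "emeasure lborel S \<noteq> 0" "emeasure lborel S \<noteq> \<infinity>"
  shows "distr lborel borel T = lborel"
proof (rule translation_invariant_eq_lborel[OF _ _ _ S(1) _ S(3,4)])
  have cont: "continuous_on X T" for X
    unfolding T_def using L(1) by (intro continuous_intros linear_continuous_on) (simp add: linear_conv_bounded_linear)
  then have T[measurable]: "T \<in> borel_measurable borel"
    by (intro borel_measurable_continuous_onI)
  have inj: "inj T" using L(2) by (auto simp: T_def inj_on_def)
  have surjL: "surj L"
    using L by (simp add: linear_injective_imp_surjective)
  have surj: "surj T"
    unfolding surj_def by (metis T_def diff_add_cancel surjL surjD)
  let ?\<nu> = "distr lborel borel T"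
  show "sets ?\<nu> = sets borel" by simp
  \<comment> \<open>The images of the balls around 0 form a countable cover by sets of finite image measure.\<close>
  show "sigma_finite_measure ?\<nu>"
  proof
    let ?C = "range (\<lambda>k::nat. T ` cball 0 (real k))"
    have C: "compact (T ` cball 0 r)" for r :: real
      by (intro compact_continuous_image cont) simp
    have "emeasure ?\<nu> (T ` cball 0 r) \<noteq> \<infinity>" for r :: real
      using C[of r] inj emeasure_bounded_finite[of "cball 0 r :: 'a set"]
      by (subst emeasure_distr) (auto intro: borel_compact simp: inj_vimage_image_eq)
    moreover have "\<Union>?C = UNIV"
    proof -
      have "(\<Union>k. cball (0::'a) (real k)) = UNIV"
        using real_arch_simple by (auto simp: dist_norm)
      then show ?thesis using surj by (metis image_UN)
    qed
    ultimately show "\<exists>A. countable A \<and> A \<subseteq> sets ?\<nu> \<and> \<Union>A = space ?\<nu> \<and> (\<forall>a\<in>A. emeasure ?\<nu> a \<noteq> \<infinity>)"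
      using C by (intro exI[of _ ?C]) (auto intro: borel_compact)
  qed
  show "distr ?\<nu> borel ((+) b) = ?\<nu>" for b
  proof -
    obtain d where d: "L d = b" using surjD[OF surjL, of b] by metis
    have "(+) b \<circ> T = T \<circ> (+) d"
      using L(1) by (auto simp: T_def fun_eq_iff linear_add d)
    then have "distr ?\<nu> borel ((+) b) = distr (distr lborel borel ((+) d)) borel T"
      by (simp add: distr_distr)
    then show ?thesis by (simp add: lborel_distr_plus)
  qed
  have "T -` S = S" using inj S(2) by (metis inj_vimage_image_eq)
  then show "emeasure ?\<nu> S = emeasure lborel S"
    using S(1) by (simp add: emeasure_distr)
qed

section \<open>The affine map that rotates the vertices of a simplex\<close>

lemma sum_cyclic_shift:
  fixes h :: "nat \<Rightarrow> 'b::comm_monoid_add"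
  shows "(\<Sum>k=0..n. h ((i + k) mod Suc n)) = sum h {0..n}"
proof (rule sum.reindex_bij_betw)
  have "inj_on (\<lambda>k. (i + k) mod Suc n) {0..n}"
  proof (rule inj_onI)
    have "k = l" if "k \<le> l" "l \<le> n" "(i + k) mod Suc n = (i + l) mod Suc n" for k l
    proof -
      have "Suc n dvd l - k"
        using that mod_eq_dvd_iff_nat[of "i + k" "i + l" "Suc n"] by simp
      then show ?thesis using that(1,2) by (auto dest: dvd_imp_le)
    qed
    then show "k = l" if "k \<in> {0..n}" "l \<in> {0..n}" "(i + k) mod Suc n = (i + l) mod Suc n" for k l
      using that by (metis atLeastAtMost_iff nle_le)
  qed
  moreover have "(\<lambda>k. (i + k) mod Suc n) ` {0..n} \<subseteq> {0..n}"
    by (auto simp: less_Suc_eq_le[symmetric] simp del: less_Suc_eq_le)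
  ultimately show "bij_betw (\<lambda>k. (i + k) mod Suc n) {0..n} {0..n}"
    by (simp add: bij_betw_def endo_inj_surj)
qed

text \<open>
  The edges from any chosen vertex form a basis. This is needed for two vertices: the edges
  from \<open>v 0\<close> carry the definition of the rotation, the edges from \<open>v 1\<close> show that it is surjective.
\<close>

lemma affinely_independent_family_edges_basis:
  fixes v :: "nat \<Rightarrow> 'a::euclidean_space"
  assumes "affinely_independent_family v {0..DIM('a)}" and "k \<le> DIM('a)"
  defines "B \<equiv> (\<lambda>x. - v k + x) ` (v ` {0..DIM('a)} - {v k})"
  shows "independent B" and "span B = UNIV"
proof -
  let ?V = "v ` {0..DIM('a)}"
  have inj: "inj_on v {0..DIM('a)}" and ind: "\<not> affine_dependent ?V"
    using assms(1) by (auto simp: affinely_independent_family_def)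
  have vk: "v k \<in> ?V" using assms(2) by auto
  show B: "independent B"
    using affine_dependent_iff_dependent2[OF vk] ind by (simp add: B_def)
  have "card B = card (?V - {v k})"
    unfolding B_def by (rule card_image) (auto intro: inj_onI)
  also have "\<dots> = DIM('a)"
    using vk by (simp add: card_image[OF inj])
  finally show "span B = UNIV"
    using card_ge_dim_independent[of B UNIV] B by auto
qed

text \<open>
  The linear part \<open>L\<close> is prescribed on the basis of edges from \<open>v 0\<close>, which it must send to the edges
  from \<open>v 1\<close>; the translation part is then forced by \<open>v 0 \<mapsto> v 1\<close>.
\<close>

lemma simplex_rotation_exists:
  fixes v :: "nat \<Rightarrow> 'a::euclidean_space"
  defines "n \<equiv> DIM('a)"
  assumes v: "affinely_independent_family v {0..n}"
  obtains L a where "linear L" "inj L" "\<And>i. i \<le> n \<Longrightarrow> L (v i) + a = v (Suc i mod Suc n)"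
proof -
  have n: "n > 0" by (simp add: n_def)
  have inj: "inj_on v {0..n}" using v by (simp add: affinely_independent_family_def)
  let ?E = "\<lambda>k. (\<lambda>x. - v k + x) ` (v ` {0..n} - {v k})"
  define \<phi> where "\<phi> x = v (Suc (the_inv_into {0..n} v (v 0 + x)) mod Suc n) - v 1" for x
  obtain L where L: "linear L" "\<And>x. x \<in> ?E 0 \<Longrightarrow> L x = \<phi> x"
    using linear_independent_extend[of "?E 0" \<phi>] affinely_independent_family_edges_basis(1)[of v 0] v
    by (auto simp: n_def)
  have edge: "L (v i - v 0) = v (Suc i mod Suc n) - v 1" if "i \<le> n" for i
  proof (cases "i = 0")
    case True
    then show ?thesis using n linear_0[OF L(1)] by simp
  next
    case False
    then have "v i \<noteq> v 0"
      using that inj by (auto dest: inj_onD)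
    then have "v i - v 0 \<in> ?E 0"
      using that by (auto simp: image_iff intro!: bexI[of _ "v i"])
    then show ?thesis
      using L(2) that inj by (simp add: \<phi>_def the_inv_into_f_f)
  qed
  have "?E 1 \<subseteq> range L"
  proof
    fix y assume "y \<in> ?E 1"
    then obtain x where x: "x \<in> v ` {0..n}" "y = - v 1 + x"
      by blast
    then obtain j where j: "j \<le> n" "y = v j - v 1"
      by fastforce
    obtain i where "i \<le> n" "Suc i mod Suc n = j"
    proof (cases j)
      case 0
      show ?thesis by (rule that[of n]) (simp_all add: 0)
    next
      case (Suc i)
      show ?thesis by (rule that[of i]) (use Suc j(1) in simp_all)
    qed
    then have "y = L (v i - v 0)" using edge j(2) by simp
    then show "y \<in> range L" by simp
  qed
  then have "span (?E 1) \<subseteq> range L"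
    using L(1) by (intro span_minimal linear_subspace_image subspace_UNIV)
  then have "surj L"
    using affinely_independent_family_edges_basis(2)[of v 1] v n by (auto simp: n_def)
  then have "inj L" using L(1) by (simp add: linear_surjective_imp_injective)
  moreover have "L (v i) + (v 1 - L (v 0)) = v (Suc i mod Suc n)" if "i \<le> n" for i
    using edge[OF that] L(1) by (simp add: linear_diff algebra_simps)
  ultimately show thesis using L(1) that by blast
qed

lemma convex_hull_family:
  assumes "inj_on v {0..n::nat}" "x \<in> convex hull (v ` {0..n})"
  obtains t where "\<And>i. i \<in> {0..n} \<Longrightarrow> 0 \<le> t i" "sum t {0..n} = 1" "x = (\<Sum>i=0..n. t i *\<^sub>R v i)"
proof -
  obtain u where u: "\<forall>y\<in>v ` {0..n}. 0 \<le> u y" "sum u (v ` {0..n}) = 1"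
     "(\<Sum>y\<in>v ` {0..n}. u y *\<^sub>R y) = x"
    using assms(2) by (auto simp: convex_hull_finite)
  show thesis
    by (rule that[of "u \<circ> v"]) (use u assms(1) in \<open>auto simp: sum.reindex o_def\<close>)
qed

text \<open>
  Affine maps act on barycentric combinations vertex by vertex, so iterating the map only
  rotates the indices.
\<close>

lemma affine_iterate_convex_combination:
  fixes v :: "nat \<Rightarrow> 'a::real_vector"
  assumes "linear L" and T: "\<And>i. i \<le> n \<Longrightarrow> L (v i) + a = v (Suc i mod Suc n)"
    and t: "sum t {0..n} = 1"
  shows "((\<lambda>x. L x + a) ^^ k) (\<Sum>i=0..n. t i *\<^sub>R v i) = (\<Sum>i=0..n. t i *\<^sub>R v ((i + k) mod Suc n))"
proof (induction k)
  case (Suc k)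
  have "((\<lambda>x. L x + a) ^^ Suc k) (\<Sum>i=0..n. t i *\<^sub>R v i)
      = L (\<Sum>i=0..n. t i *\<^sub>R v ((i + k) mod Suc n)) + (\<Sum>i=0..n. t i) *\<^sub>R a"
    by (simp add: Suc t)
  also have "\<dots> = (\<Sum>i=0..n. t i *\<^sub>R (L (v ((i + k) mod Suc n)) + a))"
    using assms(1) by (simp add: linear_sum linear_scale scaleR_sum_left scaleR_add_right sum.distrib)
  also have "\<dots> = (\<Sum>i=0..n. t i *\<^sub>R v ((i + Suc k) mod Suc n))"
    by (intro sum.cong refl) (simp add: T less_Suc_eq_le[symmetric] mod_Suc_eq)
  finally show ?case .
qed simp

section \<open>Orbits of the rotation and convex functions\<close>

text \<open>
  The linear part and the translation of \<open>T\<close> are kept apart because convex hulls and interiors are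
  carried along by each of them separately.
\<close>

locale rotated_simplex =
  fixes v :: "nat \<Rightarrow> 'a::euclidean_space" and n :: nat and L :: "'a \<Rightarrow> 'a" and a :: 'a
    and T :: "'a \<Rightarrow> 'a" and S :: "'a set"
  assumes inj_v: "inj_on v {0..n}"
    and L: "linear L" "inj L"
    and L_v: "\<And>i. i \<le> n \<Longrightarrow> L (v i) + a = v (Suc i mod Suc n)"
    and T_def: "T = (\<lambda>x. L x + a)" and S_def: "S = convex hull (v ` {0..n})"
begin

lemma image_simplex: "T ` S = S"
proof -
  have "T ` S = (\<lambda>x. a + x) ` L ` S"
    by (simp add: T_def image_image add.commute)
  also have "\<dots> = convex hull ((\<lambda>x. a + x) ` L ` v ` {0..n})"
    by (simp add: S_def convex_hull_linear_image[OF L(1)] convex_hull_translation)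
  also have "(\<lambda>x. a + x) ` L ` v ` {0..n} = v ` (\<lambda>i. Suc i mod Suc n) ` {0..n}"
    unfolding image_image by (intro image_cong refl) (use L_v in \<open>simp add: add.commute\<close>)
  also have "(\<lambda>i. Suc i mod Suc n) ` {0..n} = {0..n}"
  proof -
    have "i \<in> (\<lambda>i. Suc i mod Suc n) ` {0..n}" if "i \<le> n" for i
    proof (cases i)
      case 0
      show ?thesis by (rule image_eqI[of _ _ n]) (simp_all add: 0)
    next
      case (Suc j)
      show ?thesis by (rule image_eqI[of _ _ j]) (use that Suc in simp_all)
    qed
    then show ?thesis by (auto simp: less_Suc_eq_le[symmetric] simp del: less_Suc_eq_le)
  qed
  finally show ?thesis by (simp add: S_def)
qed

lemma image_interior: "T ` interior S = interior S"
proof -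
  have T: "T ` X = (+) a ` L ` X" for X
    by (simp add: T_def image_image add.commute)
  have "T ` interior S = interior (T ` S)"
    unfolding T by (simp add: interior_translation interior_injective_linear_image[OF L])
  then show ?thesis by (simp add: image_simplex)
qed

lemma inj_T: "inj T"
  using L(2) by (auto simp: T_def inj_on_def)

lemma vertex_mem: "i \<le> n \<Longrightarrow> v i \<in> S"
  unfolding S_def by (rule hull_inc) simp

lemma funpow_mem_interior_iff: "(T ^^ k) x \<in> interior S \<longleftrightarrow> x \<in> interior S"
proof (induction k)
  case (Suc k)
  then show ?case
    using inj_image_mem_iff[OF inj_T, of "(T ^^ k) x" "interior S"] by (simp add: image_interior)
qed simp

lemma funpow_mem: "x \<in> S \<Longrightarrow> (T ^^ k) x \<in> S"
  by (induction k) (use image_simplex in auto)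

text \<open>
  Exchanging the sum over the orbit with the sum over the vertices, each weight \<open>t i\<close> multiplies
  the full vertex sum, and the weights add up to \<open>1\<close>. Divided by \<open>n + 1\<close>: every orbit has the barycenter
  as its centroid.
\<close>

lemma sum_orbit:
  assumes "x \<in> S"
  shows "(\<Sum>k=0..n. (T ^^ k) x) = (\<Sum>i=0..n. v i)"
proof -
  obtain t where t: "sum t {0..n} = 1" "x = (\<Sum>i=0..n. t i *\<^sub>R v i)"
    using convex_hull_family[OF inj_v, of x] assms unfolding S_def by metis
  have "(\<Sum>k=0..n. (T ^^ k) x) = (\<Sum>k=0..n. \<Sum>i=0..n. t i *\<^sub>R v ((i + k) mod Suc n))"
    unfolding T_def t(2) using affine_iterate_convex_combination[where v=v, OF L(1) L_v t(1)] by simp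
  also have "\<dots> = (\<Sum>i=0..n. t i *\<^sub>R (\<Sum>k=0..n. v ((i + k) mod Suc n)))"
    by (subst sum.swap) (simp add: scaleR_sum_right)
  also have "\<dots> = (\<Sum>i=0..n. v i)"
    by (simp only: sum_cyclic_shift scaleR_sum_left[symmetric] t(1) scaleR_one)
  finally show ?thesis .
qed

text \<open>
  The pointwise form of the Hermite--Hadamard inequalities. The lower bound is Jensen's inequality
  for the centroid of the orbit. For the upper bound, Jensen's inequality bounds each
  \<open>g ((T ^^ k) x)\<close> by the vertex values with rotated weights, and these add up to \<open>1\<close> at every vertex.
\<close>

lemma convex_orbit_bounds:
  assumes g: "convex_on S g" and x: "x \<in> S"
  shows "real (n + 1) * g (barycenter n v) \<le> (\<Sum>k=0..n. g ((T ^^ k) x))"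
    and "(\<Sum>k=0..n. g ((T ^^ k) x)) \<le> (\<Sum>i=0..n. g (v i))"
proof -
  have "barycenter n v = (\<Sum>k=0..n. (1 / real (n + 1)) *\<^sub>R (T ^^ k) x)"
    by (simp add: barycenter_def sum_orbit[OF x] flip: scaleR_sum_right)
  also have "g \<dots> \<le> (\<Sum>k=0..n. 1 / real (n + 1) * g ((T ^^ k) x))"
    by (rule convex_on_sum[OF _ _ g]) (use funpow_mem[OF x] in auto)
  finally show "real (n + 1) * g (barycenter n v) \<le> (\<Sum>k=0..n. g ((T ^^ k) x))"
    by (simp add: field_simps flip: sum_distrib_left sum_divide_distrib)
  obtain t where t: "\<And>i. i \<in> {0..n} \<Longrightarrow> 0 \<le> t i" "sum t {0..n} = 1" "x = (\<Sum>i=0..n. t i *\<^sub>R v i)"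
    using convex_hull_family[OF inj_v, of x] x unfolding S_def by metis
  have "(\<Sum>k=0..n. g ((T ^^ k) x)) \<le> (\<Sum>k=0..n. \<Sum>i=0..n. t i * g (v ((i + k) mod Suc n)))"
  proof (rule sum_mono)
    fix k
    have "(T ^^ k) x = (\<Sum>i=0..n. t i *\<^sub>R v ((i + k) mod Suc n))"
      unfolding T_def t(3) by (rule affine_iterate_convex_combination[where v=v, OF L(1) L_v t(2)])
    then show "g ((T ^^ k) x) \<le> (\<Sum>i=0..n. t i * g (v ((i + k) mod Suc n)))"
      using convex_on_sum[OF _ _ g t(2), of "\<lambda>i. v ((i + k) mod Suc n)"] t(1)
      by (simp add: vertex_mem less_Suc_eq_le[symmetric] del: less_Suc_eq_le)
  qed
  also have "\<dots> = (\<Sum>i=0..n. t i * (\<Sum>k=0..n. g (v ((i + k) mod Suc n))))"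
    by (subst sum.swap) (simp add: sum_distrib_left)
  also have "\<dots> = (\<Sum>i=0..n. g (v i))"
    by (simp only: sum_cyclic_shift[of "\<lambda>i. g (v i)"] sum_distrib_right[symmetric] t(2) mult_1)
  finally show "(\<Sum>k=0..n. g ((T ^^ k) x)) \<le> (\<Sum>i=0..n. g (v i))" .
qed

text \<open>
  A convex function on a polytope is at most its largest vertex value \<open>M\<close>. Bounding all points of the
  orbit except \<open>x\<close> by \<open>M\<close> in the lower orbit bound then gives a lower bound for \<open>g x\<close>.
\<close>

lemma convex_bounded:
  assumes g: "convex_on S g"
  obtains B where "\<And>x. x \<in> S \<Longrightarrow> \<bar>g x\<bar> \<le> B"
proof -
  define M where "M = Max (g ` v ` {0..n})"
  have M: "g x \<le> M" if "x \<in> S" for x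
    unfolding M_def using convex_on_convex_hull_bound[of "v ` {0..n}" g M] g that
    by (auto simp: S_def M_def)
  have "real (n + 1) * g (barycenter n v) - real n * M \<le> g x" if "x \<in> S" for x
  proof -
    have "real (n + 1) * g (barycenter n v) \<le> g x + (\<Sum>k=Suc 0..n. g ((T ^^ k) x))"
      using convex_orbit_bounds(1)[OF g that] by (simp add: sum.atLeast_Suc_atMost[of 0 n])
    also have "(\<Sum>k=Suc 0..n. g ((T ^^ k) x)) \<le> (\<Sum>k=Suc 0..n. M)"
      by (intro sum_mono M funpow_mem that)
    finally show ?thesis by simp
  qed
  with M show thesis
    by (intro that[of "\<bar>M\<bar> + \<bar>real (n + 1) * g (barycenter n v) - real n * M\<bar>"]) (smt (verit))
qed

end

lemma rotated_simplex_exists: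
  fixes v :: "nat \<Rightarrow> 'a::euclidean_space"
  assumes "affinely_independent_family v {0..DIM('a)}"
  obtains L a where "rotated_simplex v DIM('a) L a (\<lambda>x. L x + a) (convex hull (v ` {0..DIM('a)}))"
  using simplex_rotation_exists[OF assms] assms
  unfolding rotated_simplex_def affinely_independent_family_def by metis

section \<open>The Hermite--Hadamard inequalities\<close>

lemma simplex_interior:
  fixes v :: "nat \<Rightarrow> 'a::euclidean_space"
  assumes "affinely_independent_family v {0..DIM('a)}"
  shows "interior (convex hull (v ` {0..DIM('a)})) \<noteq> {}"
  using assms interior_convex_hull_eq_empty[of "v ` {0..DIM('a)}"]
  by (simp add: affinely_independent_family_def card_image)

text \<open>
  The frontier of a convex set is negligible, so the completed measure does not see the values
  of \<open>g\<close> there, and Borel measurability on the interior is enough.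
\<close>

lemma set_integral_eq_interior_of_convex:
  fixes S :: "'a::euclidean_space set" and g :: "'a \<Rightarrow> real"
  assumes S: "convex S" "closed S"
    and int: "integrable lborel (\<lambda>x. indicator (interior S) x * g x)"
  shows "set_integrable lebesgue S g"
    and "(LINT x:S|lebesgue. g x) = (\<integral>x. indicator (interior S) x * g x \<partial>lborel)"
proof -
  let ?U = "interior S"
  have neg: "negligible {x \<in> S - ?U. P x}" "negligible {x \<in> ?U - S. P x}" for P
    using negligible_convex_frontier[OF S(1)] S(2) interior_subset[of S]
    by (auto simp: frontier_def elim!: negligible_subset)
  have U: "set_integrable lebesgue ?U g"
    using int unfolding set_integrable_def
    by (subst integrable_completion) (auto dest: borel_measurable_integrable)
  show *: "set_integrable lebesgue S g"
    using absolutely_integrable_spike_set_eq[of S ?U g, OF neg] U by simp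
  have "(LINT x:S|lebesgue. g x) = integral S g"
    using * by (rule set_lebesgue_integral_eq_integral)
  also have "\<dots> = integral ?U g"
    by (rule integral_spike_set) (use neg in auto)
  also have "\<dots> = (LINT x:?U|lebesgue. g x)"
    using U by (rule set_lebesgue_integral_eq_integral(2)[symmetric])
  also have "\<dots> = (\<integral>x. indicator ?U x * g x \<partial>lborel)"
    unfolding set_lebesgue_integral_def
    using int by (subst integral_completion) (auto dest: borel_measurable_integrable)
  finally show "(LINT x:S|lebesgue. g x) = (\<integral>x. indicator ?U x * g x \<partial>lborel)" .
qed

text \<open>
  Integrating the pointwise orbit bounds over the interior \<open>?U\<close>. The function \<open>h\<close> is \<open>g\<close> cut off outside
  \<open>?U\<close>; as \<open>?U\<close> is invariant under \<open>T\<close>, cutting off commutes with moving along orbits.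
\<close>

lemma convex_hermite_hadamard_simplex:
  fixes v :: "nat \<Rightarrow> 'a::euclidean_space" and g :: "'a \<Rightarrow> real"
  defines "n \<equiv> DIM('a)" and "S \<equiv> convex hull (v ` {0..DIM('a)})"
  assumes v: "affinely_independent_family v {0..n}" and g: "convex_on S g"
  shows "measure lebesgue S > 0" (is ?pos)
    and "set_integrable lebesgue S g" (is ?integrable)
    and "g (barycenter n v) \<le> average S g" (is ?lower)
    and "average S g \<le> 1 / real (n + 1) * (\<Sum>i=0..n. g (v i))" (is ?upper)
proof -
  obtain L a where R: "rotated_simplex v n L a (\<lambda>x. L x + a) S"
    using rotated_simplex_exists v unfolding n_def S_def by blast
  define T where "T = (\<lambda>x. L x + a)"
  interpret rotated_simplex v n L a T S using R by (simp add: T_def)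
  let ?U = "interior S" and ?b = "barycenter n v"
  have compact: "compact S" and convex: "convex S"
    by (auto simp: S_def intro: finite_imp_compact_convex_hull)
  have U_ne: "?U \<noteq> {}" using simplex_interior v by (simp add: n_def S_def)
  have US: "x \<in> S" if "x \<in> ?U" for x using that interior_subset by blast
  have U_fin: "emeasure lborel ?U < \<infinity>"
    using compact by (intro emeasure_bounded_finite bounded_interior compact_imp_bounded)
  have U_pos: "emeasure lborel ?U \<noteq> 0"
    using U_ne open_not_negligible[of ?U] by (auto simp: negligible_iff_null_sets null_sets_def)
  have m_S: "measure lebesgue S = measure lborel ?U"
    using measure_interior[OF compact_imp_bounded[OF compact] negligible_convex_frontier[OF convex]] by simp
  then show ?pos
    using U_fin U_pos by (simp add: measure_def enn2real_positive_iff top.not_eq_extremum zero_less_iff_neq_zero)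
  define h where "h x = indicator ?U x * g x" for x
  have "continuous_on ?U g"
    by (intro convex_on_continuous convex_on_subset[OF g]) (auto simp: convex interior_subset convex_interior)
  then have h[measurable]: "h \<in> borel_measurable borel"
    unfolding h_def using borel_measurable_continuous_on_indicator[of ?U g] by simp
  obtain B where B: "\<And>x. x \<in> S \<Longrightarrow> \<bar>g x\<bar> \<le> B"
    using convex_bounded[OF g] by blast
  have h_int: "integrable lborel h"
    by (rule integrableI_bounded_set[where A="?U" and B=B]) (use U_fin B US in \<open>auto simp: h_def\<close>)
  have T_borel[measurable]: "T \<in> borel_measurable borel"
    unfolding T_def using L(1)
    by (intro borel_measurable_continuous_onI continuous_intros linear_continuous_on) (simp add: linear_conv_bounded_linear)
  have distr_T: "distr lborel borel T = lborel"
    unfolding T_def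
    by (rule affine_image_eq_imp_distr_lborel[OF L, of ?U])
       (use image_interior U_pos U_fin in \<open>auto simp: T_def\<close>)
  have Tk[measurable]: "T ^^ k \<in> borel_measurable borel" for k
    by (induction k) (auto simp: id_def intro: measurable_comp)
  have distr_Tk: "distr lborel borel (T ^^ k) = lborel" for k
  proof (induction k)
    case (Suc k)
    have "distr lborel borel (T ^^ Suc k) = distr (distr lborel borel (T ^^ k)) borel T"
      by (simp add: distr_distr o_def)
    then show ?case by (simp only: Suc distr_T)
  qed (simp add: id_def distr_id2)
  have orbit_int: "integrable lborel (\<lambda>x. h ((T ^^ k) x))" for k
    using integrable_distr[of "T ^^ k" lborel borel h] h_int by (simp add: distr_Tk)
  have "(\<integral>x. h ((T ^^ k) x) \<partial>lborel) = (\<integral>x. h x \<partial>lborel)" for k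
    using integral_distr[of "T ^^ k" lborel borel h] by (simp add: distr_Tk)
  then have orbit: "(\<integral>x. (\<Sum>k=0..n. h ((T ^^ k) x)) \<partial>lborel) = real (n + 1) * (\<integral>x. h x \<partial>lborel)"
    by (subst Bochner_Integration.integral_sum) (auto intro: orbit_int)
  have orbit_eq: "(\<Sum>k=0..n. h ((T ^^ k) x)) = indicator ?U x * (\<Sum>k=0..n. g ((T ^^ k) x))" for x
    by (simp add: h_def funpow_mem_interior_iff indicator_def sum_distrib_left)
  have const: "integrable lborel (\<lambda>x. indicator ?U x * (C::real))"
       "(\<integral>x. indicator ?U x * C \<partial>lborel) = measure lebesgue S * C" for C
    using U_fin by (auto simp: m_S)
  have lower: "measure lebesgue S * (real (n + 1) * g ?b) \<le> (\<integral>x. (\<Sum>k=0..n. h ((T ^^ k) x)) \<partial>lborel)"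
    unfolding const(2)[symmetric]
    by (intro integral_mono const Bochner_Integration.integrable_sum orbit_int)
       (use convex_orbit_bounds(1)[OF g] US in \<open>auto simp: orbit_eq indicator_def\<close>)
  have upper: "(\<integral>x. (\<Sum>k=0..n. h ((T ^^ k) x)) \<partial>lborel) \<le> measure lebesgue S * (\<Sum>i=0..n. g (v i))"
    unfolding const(2)[symmetric]
    by (intro integral_mono const Bochner_Integration.integrable_sum orbit_int)
       (use convex_orbit_bounds(2)[OF g] US in \<open>auto simp: orbit_eq indicator_def\<close>)
  have S_int: "set_integrable lebesgue S g" "(LINT x:S|lebesgue. g x) = (\<integral>x. h x \<partial>lborel)"
    using set_integral_eq_interior_of_convex[OF convex compact_imp_closed[OF compact]] h_int
    unfolding h_def by auto
  show ?integrable by (fact S_int(1))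
  have "real (n + 1) * (measure lebesgue S * g ?b) \<le> real (n + 1) * (\<integral>x. h x \<partial>lborel)"
    using lower unfolding orbit by (simp only: mult.left_commute)
  then have "measure lebesgue S * g ?b \<le> (\<integral>x. h x \<partial>lborel)"
    by (rule mult_left_le_imp_le) simp
  then show ?lower
    using \<open>?pos\<close> by (simp add: average_def S_int(2) field_simps)
  show ?upper
    using upper \<open>?pos\<close> by (simp add: orbit average_def S_int(2) field_simps)
qed

text \<open>
  In an inner product space the defect of convexity of \<open>(norm x)\<^sup>2\<close> is exactly
  \<open>t * (1 - t) * (norm (x - y))\<^sup>2\<close>, so the strong convexity term is absorbed by subtracting
  \<open>c * (norm x)\<^sup>2\<close>.
\<close>

lemma strongly_convex_on_iff_convex_on_minus_norm_squared:
  fixes f :: "'a::real_inner \<Rightarrow> real"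
  shows "strongly_convex_on c D f \<longleftrightarrow> convex_on D (\<lambda>x. f x - c * (norm x)\<^sup>2)"
proof -
  have *: "(f (t *\<^sub>R x + (1 - t) *\<^sub>R y) \<le> t * f x + (1 - t) * f y - c * t * (1 - t) * (norm (x - y))\<^sup>2)
    \<longleftrightarrow> (f (t *\<^sub>R x + (1 - t) *\<^sub>R y) - c * (norm (t *\<^sub>R x + (1 - t) *\<^sub>R y))\<^sup>2
        \<le> t * (f x - c * (norm x)\<^sup>2) + (1 - t) * (f y - c * (norm y)\<^sup>2))" for t x y
  proof -
    have "(norm (t *\<^sub>R x + (1 - t) *\<^sub>R y))\<^sup>2
      = t * (norm x)\<^sup>2 + (1 - t) * (norm y)\<^sup>2 - t * (1 - t) * (norm (x - y))\<^sup>2"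
      unfolding power2_norm_eq_inner by (simp add: inner_simps inner_commute algebra_simps)
    then show ?thesis by (simp only:) (simp add: algebra_simps)
  qed
  show ?thesis
    unfolding strongly_convex_on_def convex_on_def *
  proof (intro conj_cong refl ball_cong)
    fix x y
    let ?P = "\<lambda>u v. f (u *\<^sub>R x + v *\<^sub>R y) - c * (norm (u *\<^sub>R x + v *\<^sub>R y))\<^sup>2
      \<le> u * (f x - c * (norm x)\<^sup>2) + v * (f y - c * (norm y)\<^sup>2)"
    have "u + v = 1 \<longleftrightarrow> v = 1 - u" for u v :: real by auto
    then show "(\<forall>t\<in>{0..1}. ?P t (1 - t)) \<longleftrightarrow> (\<forall>u\<ge>0. \<forall>v\<ge>0. u + v = 1 \<longrightarrow> ?P u v)"
      by (auto simp: Ball_def)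
  qed
qed

theorem theorem8:
  fixes v :: "nat \<Rightarrow> real ^ 'n" and n :: nat and S :: "(real ^ 'n) set"
    and f :: "real ^ 'n \<Rightarrow> real" and c :: real
  assumes "n = CARD('n)"
    and "affinely_independent_family v {0..n}"
    and "S = convex hull (v ` {0..n})"
    and "c > 0"
    and "strongly_convex_on c S f"
  shows "f (barycenter n v) + c * (average S (\<lambda>x. (norm x)\<^sup>2) - (norm (barycenter n v))\<^sup>2)
          \<le> average S f \<and>
        average S f
          \<le> 1 / real (n + 1) * (\<Sum>i=0..n. f (v i))
            + c * (average S (\<lambda>x. (norm x)\<^sup>2) - 1 / real (n + 1) * (\<Sum>i=0..n. (norm (v i))\<^sup>2))"
proof -
  define g where "g x = f x - c * (norm x)\<^sup>2" for x
  have n: "n = DIM(real ^ 'n)" using assms(1) by simp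
  have "convex_on S g"
    using assms(5) unfolding g_def strongly_convex_on_iff_convex_on_minus_norm_squared .
  note HH = convex_hermite_hadamard_simplex[of v g, folded n, folded assms(3), OF assms(2) this]
  have "compact S"
    unfolding assms(3) by (intro finite_imp_compact_convex_hull) simp
  then have "integrable lborel (\<lambda>x. indicator S x *\<^sub>R (norm x)\<^sup>2)"
    by (intro borel_integrable_compact continuous_intros)
  then have norm_int: "set_integrable lebesgue S (\<lambda>x. (norm x)\<^sup>2)"
    unfolding set_integrable_def
    by (subst integrable_completion) (auto dest: borel_measurable_integrable)
  have "average S f = average S (\<lambda>x. g x + c * (norm x)\<^sup>2)"
    by (simp add: g_def)
  also have "\<dots> = average S g + c * average S (\<lambda>x. (norm x)\<^sup>2)"
    using HH(2) norm_int unfolding average_def by (simp add: set_integral_add algebra_simps)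
  finally have avg: "average S f = average S g + c * average S (\<lambda>x. (norm x)\<^sup>2)" .
  have "(\<Sum>i=0..n. g (v i)) = (\<Sum>i=0..n. f (v i)) - c * (\<Sum>i=0..n. (norm (v i))\<^sup>2)"
    by (simp add: g_def sum_subtractf sum_distrib_left)
  then have "average S g
      \<le> 1 / real (n + 1) * (\<Sum>i=0..n. f (v i)) - c * (1 / real (n + 1) * (\<Sum>i=0..n. (norm (v i))\<^sup>2))"
    using HH(4) by (simp only: right_diff_distrib mult.left_commute)
  moreover have "f (barycenter n v) - c * (norm (barycenter n v))\<^sup>2 \<le> average S g"
    using HH(3) by (simp add: g_def)
  ultimately show ?thesis
    unfolding avg right_diff_distrib by linarith
qed

end
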